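(* Let $X$ be an infinite dimensional reflexive real Banach space. Then $K_a(X)>1$.
   Context: For a Banach space $X$, $B_X$ denotes its closed unit ball and $X^*$ its dual. For positive constants $c_1,c_2,d$, a subset $S$ of a normed space $X$ is called a $(c_1,c_2,d)$-b.s.a. (bounded and separated antipodal) subset of $X$ if (1) $\|x\|\le c_1$ for all $x\in S$, and (2) for every $x,y\in S$ with $x\ne y$ there exists $f\in X^*$ with $\|f\|\le c_2$ such that $d\le f(y)-f(x)$ and $f(x)\le f(z)\le f(y)$ for all $z\in S$. For an infinite dimensional Banach space $X$, $$K_a(X)=\sup\{d>0:\ \text{there exists an infinite } S\subseteq B_X \text{ which is a } (1,1,d)\text{-b.s.a. subset of } X\}.$$ *)

theory Defs
  imports "HOL-Analysis.Analysis"
begin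

text \<open>
  The dual of a real normed space \<open>'a\<close> is \<open>'a \<Rightarrow>\<^sub>L real\<close> with the operator norm. A space is
  represented by its type, so notions that depend only on the space take an \<open>itself\<close> argument.
\<close>

definition infinite_dimensional :: "'a::real_vector itself \<Rightarrow> bool" where
  "infinite_dimensional _ \<longleftrightarrow> \<not> (\<exists>B :: 'a set. finite B \<and> span B = UNIV)"

definition bidual_embedding :: "'a::real_normed_vector \<Rightarrow> ('a \<Rightarrow>\<^sub>L real) \<Rightarrow>\<^sub>L real" where
  "bidual_embedding x = Blinfun (\<lambda>f. blinfun_apply f x)"

lemma bidual_embedding_apply [simp]:
  "blinfun_apply (bidual_embedding x) f = blinfun_apply f x"
  by (simp add: bidual_embedding_def bounded_linear_Blinfun_apply bounded_linear_intros)

definition reflexive_space :: "'a::real_normed_vector itself \<Rightarrow> bool" where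
  "reflexive_space _ \<longleftrightarrow> surj (bidual_embedding :: 'a \<Rightarrow> ('a \<Rightarrow>\<^sub>L real) \<Rightarrow>\<^sub>L real)"

definition bsa :: "real \<Rightarrow> real \<Rightarrow> real \<Rightarrow> 'a::real_normed_vector set \<Rightarrow> bool" where
  "bsa c1 c2 d S \<longleftrightarrow>
     (\<forall>x\<in>S. norm x \<le> c1) \<and>
     (\<forall>x\<in>S. \<forall>y\<in>S. x \<noteq> y \<longrightarrow>
        (\<exists>f :: 'a \<Rightarrow>\<^sub>L real. norm f \<le> c2 \<and>
           d \<le> blinfun_apply f y - blinfun_apply f x \<and>
           (\<forall>z\<in>S. blinfun_apply f x \<le> blinfun_apply f z \<and>
                  blinfun_apply f z \<le> blinfun_apply f y)))"

definition K_a_set :: "'a::real_normed_vector itself \<Rightarrow> real set" where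
  "K_a_set _ = {d. 0 < d \<and> (\<exists>S :: 'a set. infinite S \<and> S \<subseteq> cball 0 1 \<and> bsa 1 1 d S)}"

definition K_a :: "'a::real_normed_vector itself \<Rightarrow> real" where
  "K_a X = Sup (K_a_set X)"

text \<open>
  The supremum in \<open>K_a\<close> is over a set bounded by \<open>2\<close>. The supremum of the empty set is
  an unspecified real in HOL, so \<open>K_a\<close> is meaningful only if \<open>K_a_set\<close> is nonempty.
  This holds for every infinite-dimensional Banach space: for a normalized basic sequence with
  biorthogonal functionals \<open>f\<^sub>n\<close> of bounded norm, the multiples of \<open>f\<^sub>n - f\<^sub>m\<close> are witnesses.
\<close>

lemma bdd_above_K_a_set: "bdd_above (K_a_set TYPE('a::real_normed_vector))"
proof (rule bdd_aboveI[where M = 2])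
  fix d assume "d \<in> K_a_set TYPE('a)"
  then obtain S :: "'a set" where S: "infinite S" "bsa 1 1 d S"
    by (auto simp: K_a_set_def)
  then obtain x where x: "x \<in> S" by fastforce
  have "infinite (S - {x})" using S by simp
  then have "S - {x} \<noteq> {}" by (metis finite.emptyI)
  then obtain y where y: "y \<in> S" "x \<noteq> y" by auto
  obtain f :: "'a \<Rightarrow>\<^sub>L real" where f: "norm f \<le> 1" "d \<le> blinfun_apply f y - blinfun_apply f x"
    using S x y unfolding bsa_def by meson
  have "d \<le> norm (blinfun_apply f (y - x))"
    using f by (simp add: blinfun.diff_right)
  also have "\<dots> \<le> norm f * norm (y - x)" by (rule norm_blinfun)
  also have "\<dots> \<le> 1 * (norm y + norm x)"
    using f by (intro mult_mono norm_triangle_ineq4) auto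
  also have "\<dots> \<le> 2"
  proof -
    have "norm x \<le> 1" "norm y \<le> 1" using S(2) x y(1) unfolding bsa_def by blast+
    then show ?thesis by simp
  qed
  finally show "d \<le> 2" .
qed

end

theory Submission
  imports Defs
begin

text \<open>
  Weakly null behaviour is measured along filters on the space \<open>X\<close> itself: a filter is
  normalized weakly null if along it the norm tends to \<open>1\<close> and every functional tends to \<open>0\<close>.
  Such proper filters exist because in infinite dimension finitely many functionals have a
  common zero of norm \<open>1\<close>.

  \<^emph>\<open>A separated ultrafilter gives a b.s.a. set\<close> (\<open>separated_ultrafilter_selection\<close>,
  \<open>separated_ultrafilter_K_a\<close>). Let \<open>U\<close> be a normalized weakly null ultrafilter with
  \<open>\<parallel>x - y\<parallel> \<ge> 1 + e\<close> for \<open>U\<close>-almost all \<open>x\<close> and then \<open>U\<close>-almost all \<open>y\<close>. A functional of norm at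
  most \<open>1\<close> that norms \<open>x - y\<close> must be at least about \<open>e\<close> at \<open>x\<close> and at most about \<open>- e\<close> at \<open>y\<close>,
  because the points have norm about \<open>1\<close>. By taking iterated limits of these functionals along
  \<open>U\<close>, one can select infinitely many points so that each of them is small at all other
  selected points. The points at which it is extremal on the selected set are then \<open>x\<close> and \<open>y\<close>.

  \<^emph>\<open>Without a separated ultrafilter there is a contradiction.\<close> If none exists, the
  distribution of \<open>x - y\<close>, where \<open>x\<close> and then \<open>y\<close> follow a normalized weakly null ultrafilter, is
  again normalized weakly null; the lower estimate of the norm is automatic. So the set of
  normalized weakly null ultrafilters, which is closed in the Stone-Cech compactification of the
  discrete space \<open>X\<close>, is invariant under the map \<open>\<Delta>\<close> that sends \<open>U\<close> to the distribution of
  differences. As in the proof of the Ellis lemma, Zorn's lemma gives a minimal nonempty closed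
  invariant set \<open>K\<close>, and minimality forces \<open>K = closure (\<Delta> K)\<close>
  (\<open>ex_difference_invariant_filter\<close>; closed sets of ultrafilters are represented by filters).
  A set that is large for a member of \<open>K\<close> is therefore large for a member of \<open>\<Delta> K\<close>, and
  unfolding this again and again produces \<open>y\<^sub>1, y\<^sub>2, \<dots>\<close> such that all alternating sums
  \<open>y\<^sub>1 - y\<^sub>2 + \<dots> \<plusminus> y\<^sub>n\<close> have norm at most \<open>2\<close>, together with bounded functionals: the one that
  belongs to \<open>y\<^sub>n\<close> is almost \<open>0\<close> at the sums before \<open>y\<^sub>n\<close> is added and exceeds \<open>1/2\<close> in modulus at
  all sums afterwards (\<open>difference_invariant_step\<close>). The two iterated limits of these functionals at the
  partial sums disagree, which cannot happen in a reflexive space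
  (\<open>reflexive_iterated_limits\<close>).
\<close>

section \<open>Norming functionals\<close>

text \<open>
  Norming functionals come from a form of the Hahn-Banach theorem: a minimal sublinear functional
  is linear. In \<open>sublinear\<close> the inequality for scalars is enough, as applying it to
  \<open>1 / t\<close> gives equality; this makes the property easy to verify for infima.
\<close>

definition sublinear :: "('a::real_vector \<Rightarrow> real) \<Rightarrow> bool" where
  "sublinear p \<longleftrightarrow> (\<forall>x y. p (x + y) \<le> p x + p y) \<and> (\<forall>t x. 0 \<le> t \<longrightarrow> p (t *\<^sub>R x) \<le> t * p x)"

lemma sublinear_add: "sublinear p \<Longrightarrow> p (x + y) \<le> p x + p y"
  and sublinear_scale_le: "sublinear p \<Longrightarrow> 0 \<le> t \<Longrightarrow> p (t *\<^sub>R x) \<le> t * p x"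
  by (auto simp: sublinear_def)

lemma sublinear_zero: "sublinear p \<Longrightarrow> p 0 = 0"
  using sublinear_scale_le[of p 0 0] sublinear_add[of p 0 0] by simp

lemma sublinear_scale:
  assumes "sublinear p" "0 \<le> t" shows "p (t *\<^sub>R x) = t * p x"
proof (cases "t = 0")
  case True then show ?thesis using sublinear_zero[OF assms(1)] by simp
next
  case False
  then have "0 < t" using assms by simp
  have "p x = p ((1/t) *\<^sub>R (t *\<^sub>R x))" using False by simp
  also have "\<dots> \<le> (1/t) * p (t *\<^sub>R x)" using assms by (intro sublinear_scale_le) auto
  finally have "t * p x \<le> p (t *\<^sub>R x)" using \<open>0 < t\<close> by (simp add: field_simps)
  then show ?thesis using sublinear_scale_le[OF assms, of x] by simp
qed

lemma sublinear_ge: "sublinear p \<Longrightarrow> - p (- x) \<le> p x"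
  using sublinear_add[of p x "- x"] sublinear_zero[of p] by simp

lemma ex_minimal_sublinear:
  fixes p0 :: "'a::real_vector \<Rightarrow> real"
  assumes p0: "sublinear p0"
  shows "\<exists>p. sublinear p \<and> p \<le> p0 \<and> (\<forall>q. sublinear q \<longrightarrow> q \<le> p \<longrightarrow> q = p)"
proof -
  let ?A = "{p. sublinear p \<and> p \<le> p0}" and ?P = "\<lambda>p q :: 'a \<Rightarrow> real. q \<le> p"
  have "\<exists>m\<in>?A. \<forall>a\<in>?A. ?P m a \<longrightarrow> a = m"
  proof (rule predicate_Zorn)
    show "partial_order_on ?A (relation_of ?P ?A)"
      by (rule partial_order_on_relation_ofI) auto
  next
    fix C assume C: "C \<in> Chains (relation_of ?P ?A)"
    then have CA: "p \<in> ?A" if "p \<in> C" for p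
      using that by (auto simp: Chains_def relation_of_def)
    have chain: "p \<le> q \<or> q \<le> p" if "p \<in> C" "q \<in> C" for p q
      using C that by (auto simp: Chains_def relation_of_def)
    show "\<exists>u\<in>?A. \<forall>a\<in>C. ?P a u"
    proof (cases "C = {}")
      case True then show ?thesis using p0 by auto
    next
      case False
      define u where "u x = (INF p\<in>C. p x)" for x
      have bdd: "bdd_below ((\<lambda>p. p x) ` C)" for x
      proof (rule bdd_belowI2)
        fix p assume "p \<in> C"
        then have "sublinear p" "p (- x) \<le> p0 (- x)" using CA by (auto simp: le_fun_def)
        then show "- p0 (- x) \<le> p x" using sublinear_ge[of p x] by simp
      qed
      have le: "u x \<le> p x" if "p \<in> C" for p x
        unfolding u_def by (rule cINF_lower[OF bdd that])
      have ge: "c \<le> u x" if "\<And>p. p \<in> C \<Longrightarrow> c \<le> p x" for c x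
        unfolding u_def by (rule cINF_greatest[OF False that])
      have "u (x + y) \<le> u x + u y" for x y
      proof -
        have "u (x + y) - q y \<le> u x" if q: "q \<in> C" for q
        proof (rule ge)
          fix p assume p: "p \<in> C"
          obtain m where m: "m \<in> C" "m \<le> p" "m \<le> q" using chain[OF p q] p q by blast
          have "u (x + y) \<le> m x + m y"
            using le[OF m(1), of "x + y"] sublinear_add[of m x y] CA[OF m(1)] by auto
          then show "u (x + y) - q y \<le> p x" using le_funD[OF m(2), of x] le_funD[OF m(3), of y] by simp
        qed
        then have "u (x + y) - u x \<le> u y" by (intro ge) (simp add: algebra_simps)
        then show ?thesis by simp
      qed
      moreover have "u (t *\<^sub>R x) \<le> t * u x" if "0 \<le> t" for t x
      proof -
        have b: "u (t *\<^sub>R x) \<le> t * p x" if "p \<in> C" for p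
          using le[OF that, of "t *\<^sub>R x"] sublinear_scale_le[of p t x] CA[OF that] \<open>0 \<le> t\<close> by auto
        show ?thesis
        proof (cases "t = 0")
          case True then show ?thesis using b False by auto
        next
          case f: False
          then have "u (t *\<^sub>R x) / t \<le> u x" using b \<open>0 \<le> t\<close> by (intro ge) (simp add: field_simps)
          then show ?thesis using f \<open>0 \<le> t\<close> by (simp add: field_simps)
        qed
      qed
      ultimately have "sublinear u" by (auto simp: sublinear_def)
      moreover obtain p where "p \<in> C" using False by auto
      then have "u \<le> p0" using CA[of p] le[of p] by (auto simp: le_fun_def intro: order_trans)
      ultimately show ?thesis using le by (auto simp: le_fun_def)
    qed
  qed
  then show ?thesis by (auto intro: order_trans)
qed

text \<open>
  The largest sublinear functional below \<open>p\<close> with value at most \<open>- p y\<close> at \<open>- y\<close>.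
  A minimal \<open>p\<close> satisfies \<open>tilt p y = p\<close> for all \<open>y\<close>, which is superadditivity.
\<close>
definition tilt :: "('a::real_vector \<Rightarrow> real) \<Rightarrow> 'a \<Rightarrow> 'a \<Rightarrow> real" where
  "tilt p y x = (INF t\<in>{0..}. p (x + t *\<^sub>R y) - t * p y)"

lemma tilt_le:
  assumes "sublinear p" "0 \<le> t"
  shows "tilt p y x \<le> p (x + t *\<^sub>R y) - t * p y"
  unfolding tilt_def
proof (rule cINF_lower)
  show "bdd_below ((\<lambda>t. p (x + t *\<^sub>R y) - t * p y) ` {0..})"
  proof (rule bdd_belowI2)
    fix t :: real assume "t \<in> {0..}"
    then show "- p (- x) \<le> p (x + t *\<^sub>R y) - t * p y"
      using sublinear_add[OF assms(1), of "x + t *\<^sub>R y" "- x"] sublinear_scale[OF assms(1), of t y]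
      by simp
  qed
qed (use assms in auto)

lemma tilt_greatest: "(\<And>t. 0 \<le> t \<Longrightarrow> c \<le> p (x + t *\<^sub>R y) - t * p y) \<Longrightarrow> c \<le> tilt p y x"
  unfolding tilt_def by (rule cINF_greatest) auto

lemma tilt_le_self: "sublinear p \<Longrightarrow> tilt p y \<le> p"
  using tilt_le[of p 0] by (auto simp: le_fun_def)

lemma sublinear_tilt:
  assumes p: "sublinear p" shows "sublinear (tilt p y)"
proof -
  have "tilt p y (x + x') \<le> tilt p y x + tilt p y x'" for x x'
  proof -
    have "tilt p y (x + x') - (p (x' + t' *\<^sub>R y) - t' * p y) \<le> tilt p y x" if t': "0 \<le> t'" for t'
    proof (rule tilt_greatest)
      fix t :: real assume t: "0 \<le> t"
      have "tilt p y (x + x') \<le> p ((x + t *\<^sub>R y) + (x' + t' *\<^sub>R y)) - (t + t') * p y"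
        using tilt_le[OF p, of "t + t'" y "x + x'"] t t' by (simp add: algebra_simps)
      then show "tilt p y (x + x') - (p (x' + t' *\<^sub>R y) - t' * p y) \<le> p (x + t *\<^sub>R y) - t * p y"
        using sublinear_add[OF p, of "x + t *\<^sub>R y" "x' + t' *\<^sub>R y"] by (simp add: algebra_simps)
    qed
    then have "tilt p y (x + x') - tilt p y x \<le> tilt p y x'"
      by (intro tilt_greatest) (simp add: algebra_simps)
    then show ?thesis by simp
  qed
  moreover have "tilt p y (s *\<^sub>R x) \<le> s * tilt p y x" if s: "0 \<le> s" for s x
  proof (cases "s = 0")
    case True
    then show ?thesis using tilt_le[OF p, of 0 y 0] sublinear_zero[OF p] by simp
  next
    case False
    have "tilt p y (s *\<^sub>R x) / s \<le> tilt p y x"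
    proof (rule tilt_greatest)
      fix t :: real assume t: "0 \<le> t"
      have "tilt p y (s *\<^sub>R x) \<le> p (s *\<^sub>R (x + t *\<^sub>R y)) - s * t * p y"
        using tilt_le[OF p, of "s * t" y "s *\<^sub>R x"] s t by (simp add: algebra_simps)
      also have "\<dots> = s * (p (x + t *\<^sub>R y) - t * p y)"
        using sublinear_scale[OF p s, of "x + t *\<^sub>R y"] by (simp add: algebra_simps)
      finally show "tilt p y (s *\<^sub>R x) / s \<le> p (x + t *\<^sub>R y) - t * p y"
        using s False by (simp add: field_simps)
    qed
    then show ?thesis using s False by (simp add: field_simps)
  qed
  ultimately show ?thesis by (auto simp: sublinear_def)
qed

lemma tilt_neg: "sublinear p \<Longrightarrow> tilt p y (- y) \<le> - p y"
  using tilt_le[of p 1 y "- y"] sublinear_zero[of p] by simp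

text \<open>
  Starting the minimization from \<open>tilt norm x0\<close> instead of the norm forces the value at \<open>x0\<close>.
\<close>
lemma ex_norming_functional:
  fixes x0 :: "'a::real_normed_vector"
  shows "\<exists>f :: 'a \<Rightarrow>\<^sub>L real. norm f \<le> 1 \<and> blinfun_apply f x0 = norm x0"
proof -
  have sn: "sublinear (norm :: 'a \<Rightarrow> real)" by (auto simp: sublinear_def norm_triangle_ineq)
  obtain p where p: "sublinear p" "p \<le> tilt norm x0"
    and min: "\<And>q. sublinear q \<Longrightarrow> q \<le> p \<Longrightarrow> q = p"
    using ex_minimal_sublinear[OF sublinear_tilt[OF sn]] by blast
  have p_norm: "p x \<le> norm x" for x
    using p(2) tilt_le_self[OF sn, of x0] by (auto simp: le_fun_def intro: order_trans)
  have "tilt p y = p" for y by (rule min[OF sublinear_tilt tilt_le_self]) fact+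
  then have "p x + p y \<le> p (x + y)" for x y
    using tilt_le[OF p(1), of 1 y x] by simp
  then have add: "p (x + y) = p x + p y" for x y
    using sublinear_add[OF p(1), of x y] by (simp add: antisym)
  have neg: "p (- x) = - p x" for x using add[of x "- x"] sublinear_zero[OF p(1)] by simp
  have scale: "p (r *\<^sub>R x) = r * p x" for r x
    using sublinear_scale[OF p(1), of r x] sublinear_scale[OF p(1), of "- r" "x"] neg[of "r *\<^sub>R x"]
    by (cases "0 \<le> r") auto
  have bound: "norm (p x) \<le> 1 * norm x" for x
    using p_norm[of x] p_norm[of "- x"] neg[of x] by (simp add: abs_le_iff)
  have bl: "bounded_linear p"
    by (rule bounded_linear_intro[where K = 1]) (use add scale bound in auto)
  have "p (- x0) \<le> - norm x0"
    using p(2) tilt_neg[OF sn, of x0] by (auto simp: le_fun_def intro: order_trans)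
  then have "p x0 = norm x0" using neg[of x0] p_norm[of x0] by simp
  moreover have "norm (Blinfun p) \<le> 1"
    by (rule norm_blinfun_bound) (use bound bl in \<open>auto simp: bounded_linear_Blinfun_apply\<close>)
  ultimately show ?thesis
    using bl by (intro exI[of _ "Blinfun p"]) (simp add: bounded_linear_Blinfun_apply)
qed

text \<open>
  Oddness lets one condition on the functional for \<open>x - y\<close> serve both orders of the pair.
\<close>
lemma ex_odd_norming_map:
  "\<exists>N :: 'a::real_normed_vector \<Rightarrow> 'a \<Rightarrow>\<^sub>L real.
     \<forall>v. norm (N v) \<le> 1 \<and> blinfun_apply (N v) v = norm v \<and> N (- v) = - N v"
proof -
  obtain M :: "'a \<Rightarrow> 'a \<Rightarrow>\<^sub>L real" where M: "\<And>v. norm (M v) \<le> 1" "\<And>v. blinfun_apply (M v) v = norm v"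
    using ex_norming_functional by metis
  define N where "N v = (1/2) *\<^sub>R (M v - M (- v))" for v
  have "norm (N v) \<le> 1" for v
  proof -
    have "norm (M v - M (- v)) \<le> norm (M v) + norm (M (- v))" by (rule norm_triangle_ineq4)
    then show ?thesis using M(1)[of v] M(1)[of "- v"] by (simp add: N_def)
  qed
  moreover have "blinfun_apply (N v) v = norm v" for v
    using M(2)[of v] M(2)[of "- v"]
    by (simp add: N_def blinfun.diff_left blinfun.scaleR_left blinfun.minus_right)
  moreover have "N (- v) = - N v" for v by (simp add: N_def algebra_simps)
  ultimately show ?thesis by blast
qed

section \<open>Ultrafilters and weak limits\<close>

definition ultrafilter :: "'i filter \<Rightarrow> bool" where
  "ultrafilter U \<longleftrightarrow> U \<noteq> bot \<and> (\<forall>P. eventually P U \<or> eventually (\<lambda>x. \<not> P x) U)"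

lemma ultrafilter_not_eventually:
  assumes "ultrafilter U"
  shows "\<not> eventually P U \<longleftrightarrow> eventually (\<lambda>x. \<not> P x) U"
  using assms eventually_conj[of P U "\<lambda>x. \<not> P x"] by (auto simp: ultrafilter_def trivial_limit_def)

lemma eventually_Inf_chain:
  assumes "C \<noteq> {}" "\<And>F G. F \<in> C \<Longrightarrow> G \<in> C \<Longrightarrow> F \<le> G \<or> G \<le> F"
  shows "eventually P (Inf C) \<longleftrightarrow> (\<exists>F\<in>C. eventually P F)"
  using assms by (intro eventually_Inf_base) (auto simp: le_inf_iff)

text \<open>
  Compactness of the space of ultrafilters, in the form that a nonempty chain of proper filters has a
  proper infimum, makes Zorn's lemma applicable to proper filters.
\<close>
lemma ex_minimal_filter:
  fixes F0 :: "'a filter"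
  assumes F0: "Q F0" "F0 \<noteq> bot"
    and chain: "\<And>C. C \<noteq> {} \<Longrightarrow> (\<And>F. F \<in> C \<Longrightarrow> Q F) \<Longrightarrow> (\<And>F G. F \<in> C \<Longrightarrow> G \<in> C \<Longrightarrow> F \<le> G \<or> G \<le> F) \<Longrightarrow> Q (Inf C)"
  shows "\<exists>F\<le>F0. F \<noteq> bot \<and> Q F \<and> (\<forall>G\<le>F. G \<noteq> bot \<longrightarrow> Q G \<longrightarrow> G = F)"
proof -
  let ?A = "{F. F \<noteq> bot \<and> Q F \<and> F \<le> F0}" and ?P = "\<lambda>F G :: 'a filter. G \<le> F"
  have "\<exists>m\<in>?A. \<forall>a\<in>?A. ?P m a \<longrightarrow> a = m"
  proof (rule predicate_Zorn)
    show "partial_order_on ?A (relation_of ?P ?A)"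
      by (rule partial_order_on_relation_ofI) auto
  next
    fix C assume C: "C \<in> Chains (relation_of ?P ?A)"
    then have CA: "F \<in> ?A" if "F \<in> C" for F
      using that by (auto simp: Chains_def relation_of_def)
    have ch: "F \<le> G \<or> G \<le> F" if "F \<in> C" "G \<in> C" for F G
      using C that by (auto simp: Chains_def relation_of_def)
    show "\<exists>u\<in>?A. \<forall>a\<in>C. ?P a u"
    proof (cases "C = {}")
      case True then show ?thesis using F0 by auto
    next
      case False
      have "Inf C \<noteq> bot"
        using CA eventually_Inf_chain[OF False ch, of "\<lambda>_. False"] by (auto simp: trivial_limit_def)
      moreover have "Q (Inf C)" using CA by (intro chain[OF False _ ch]) auto
      moreover obtain F where "F \<in> C" using False by blast
      then have "Inf C \<le> F0" using CA[of F] by (auto intro: Inf_lower2)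
      ultimately show ?thesis by (auto intro: Inf_lower)
    qed
  qed
  then show ?thesis by (auto intro: order_trans)
qed

lemma ex_ultrafilter_le:
  assumes "F \<noteq> bot" shows "\<exists>U\<le>F. ultrafilter U"
proof -
  obtain U where U: "U \<le> F" "U \<noteq> bot" "\<And>G. G \<le> U \<Longrightarrow> G \<noteq> bot \<Longrightarrow> G = U"
    using ex_minimal_filter[of "\<lambda>_. True", OF _ assms] by auto
  have "eventually P U" if "\<not> eventually (\<lambda>x. \<not> P x) U" for P
  proof -
    have "inf U (principal {x. P x}) \<noteq> bot"
      using that by (auto simp: trivial_limit_def eventually_inf_principal)
    then have "inf U (principal {x. P x}) = U" by (intro U(3)) auto
    moreover have "eventually P (inf U (principal {x. P x}))"
      by (simp add: eventually_inf_principal)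
    ultimately show ?thesis by simp
  qed
  then show ?thesis using U(1,2) by (auto simp: ultrafilter_def)
qed

lemma ultrafilter_tendsto_real:
  fixes g :: "'i \<Rightarrow> real"
  assumes U: "ultrafilter U" and b: "\<And>i. \<bar>g i\<bar> \<le> B"
  shows "\<exists>l. (g \<longlongrightarrow> l) U"
proof -
  have "compact {-B..B}" by simp
  moreover have "filtermap g U \<noteq> bot" using U by (simp add: ultrafilter_def filtermap_bot_iff)
  moreover have "eventually (\<lambda>y. y \<in> {-B..B}) (filtermap g U)"
    using b by (auto simp: eventually_filtermap abs_le_iff minus_le_iff intro!: always_eventually)
  ultimately obtain l where l: "inf (nhds l) (filtermap g U) \<noteq> bot"
    unfolding compact_filter by blast
  have "eventually (\<lambda>i. g i \<in> S) U" if S: "open S" "l \<in> S" for S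
  proof (rule ccontr)
    assume "\<not> ?thesis"
    then have "eventually (\<lambda>i. g i \<notin> S) U" using ultrafilter_not_eventually[OF U] by blast
    then have "eventually (\<lambda>y. y \<notin> S) (filtermap g U)" by (simp add: eventually_filtermap)
    moreover have "eventually (\<lambda>y. y \<in> S) (nhds l)" using S by (auto simp: eventually_nhds)
    ultimately have "eventually (\<lambda>_. False) (inf (nhds l) (filtermap g U))"
      unfolding eventually_inf by blast
    then show False using l by (simp add: trivial_limit_def)
  qed
  then show ?thesis by (auto simp: tendsto_def)
qed

lemma ultrafilter_functional_limit:
  fixes g :: "'i \<Rightarrow> 'a::real_normed_vector \<Rightarrow>\<^sub>L real"
  assumes U: "ultrafilter U" and b: "\<And>i. norm (g i) \<le> B"
  shows "\<exists>h. norm h \<le> B \<and> (\<forall>x. ((\<lambda>i. blinfun_apply (g i) x) \<longlongrightarrow> blinfun_apply h x) U)"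
proof -
  have nb: "U \<noteq> bot" using U by (simp add: ultrafilter_def)
  have bx: "\<bar>blinfun_apply (g i) x\<bar> \<le> B * norm x" for i x
    using norm_blinfun[of "g i" x] mult_right_mono[OF b[of i] norm_ge_zero[of x]] by simp
  have "0 \<le> B" by (rule order_trans[OF norm_ge_zero b])
  have "\<exists>l. ((\<lambda>i. blinfun_apply (g i) x) \<longlongrightarrow> l) U" for x
    by (rule ultrafilter_tendsto_real[OF U]) (rule bx)
  then obtain h where h: "\<And>x. ((\<lambda>i. blinfun_apply (g i) x) \<longlongrightarrow> h x) U"
    by metis
  have hb: "norm (h x) \<le> B * norm x" for x
    using tendsto_upperbound[OF tendsto_rabs[OF h] _ nb, of x "B * norm x"] bx by simp
  have bl: "bounded_linear h"
  proof (rule bounded_linear_intro[where K = B])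
    show "h (x + y) = h x + h y" for x y
      using tendsto_unique[OF nb h[of "x + y"]] tendsto_add[OF h[of x] h[of y]]
      by (simp add: blinfun.add_right)
    show "h (r *\<^sub>R x) = r *\<^sub>R h x" for r x
      using tendsto_unique[OF nb h[of "r *\<^sub>R x"]] tendsto_mult_left[OF h[of x], of r]
      by (simp add: blinfun.scaleR_right)
  qed (use hb in \<open>simp add: mult.commute\<close>)
  have "norm (Blinfun h) \<le> B"
    by (rule norm_blinfun_bound) (use \<open>0 \<le> B\<close> hb bl in \<open>auto simp: bounded_linear_Blinfun_apply\<close>)
  then show ?thesis using h bl
    by (intro exI[of _ "Blinfun h"]) (simp add: bounded_linear_Blinfun_apply)
qed

lemma norm_bidual_embedding_le: "norm (bidual_embedding x) \<le> norm x"
proof (rule norm_blinfun_bound)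
  show "norm (blinfun_apply (bidual_embedding x) f) \<le> norm x * norm f" for f
    using norm_blinfun[of f x] by (simp add: mult.commute)
qed simp

text \<open>
  The limits of \<open>f (s i)\<close> define a bounded functional on the dual; reflexivity says that it is
  evaluation at a point.
\<close>
lemma reflexive_weak_limit:
  fixes s :: "'i \<Rightarrow> 'a::real_normed_vector"
  assumes "reflexive_space TYPE('a)" and U: "ultrafilter U" and b: "\<And>i. norm (s i) \<le> B"
  shows "\<exists>x. \<forall>f :: 'a \<Rightarrow>\<^sub>L real. ((\<lambda>i. blinfun_apply f (s i)) \<longlongrightarrow> blinfun_apply f x) U"
proof -
  have "norm (bidual_embedding (s i)) \<le> B" for i
    by (rule order_trans[OF norm_bidual_embedding_le b])
  then obtain h where
    h: "\<And>f :: 'a \<Rightarrow>\<^sub>L real. ((\<lambda>i. blinfun_apply f (s i)) \<longlongrightarrow> blinfun_apply h f) U"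
    using ultrafilter_functional_limit[OF U, of "\<lambda>i. bidual_embedding (s i)" B] by auto
  obtain x where "h = bidual_embedding x"
    using assms(1) unfolding reflexive_space_def by (metis surjD)
  then show ?thesis using h by auto
qed

text \<open>
  Let \<open>x\<close> and \<open>g\<close> be weak limits of the points and of the functionals. Letting the point index go
  to infinity first shows \<open>\<bar>g x\<bar> \<ge> c\<close>, and letting the functional index go first shows
  \<open>g x = 0\<close>. In the nonreflexive space \<open>c\<^sub>0\<close>, the sums \<open>s k\<close> of the first \<open>k\<close> unit vectors and the
  coordinate functionals \<open>h i\<close> satisfy these bounds and limits with \<open>c = 1\<close>.
\<close>
lemma reflexive_iterated_limits:
  fixes s :: "nat \<Rightarrow> 'a::real_normed_vector" and h :: "nat \<Rightarrow> 'a \<Rightarrow>\<^sub>L real"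
  assumes refl: "reflexive_space TYPE('a)"
    and "\<And>k. norm (s k) \<le> B" "\<And>i. norm (h i) \<le> B'"
    and upper: "\<And>i k. i < k \<Longrightarrow> c \<le> \<bar>blinfun_apply (h i) (s k)\<bar>"
    and lower: "\<And>m. (\<lambda>i. blinfun_apply (h i) (s m)) \<longlonglongrightarrow> 0"
  shows "c \<le> 0"
proof -
  obtain W :: "nat filter" where W: "W \<le> sequentially" "ultrafilter W"
    using ex_ultrafilter_le[of sequentially] by auto
  have nb: "W \<noteq> bot" using W by (simp add: ultrafilter_def)
  have "\<exists>x. \<forall>f :: 'a \<Rightarrow>\<^sub>L real. ((\<lambda>i. blinfun_apply f (s i)) \<longlongrightarrow> blinfun_apply f x) W"
    by (rule reflexive_weak_limit[OF refl W(2)]) (rule assms(2))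
  then obtain x where x: "\<And>f :: 'a \<Rightarrow>\<^sub>L real. ((\<lambda>i. blinfun_apply f (s i)) \<longlongrightarrow> blinfun_apply f x) W"
    by blast
  have "\<exists>g. norm g \<le> B' \<and> (\<forall>x. ((\<lambda>i. blinfun_apply (h i) x) \<longlongrightarrow> blinfun_apply g x) W)"
    by (rule ultrafilter_functional_limit[OF W(2)]) (rule assms(3))
  then obtain g where g: "\<And>x. ((\<lambda>i. blinfun_apply (h i) x) \<longlongrightarrow> blinfun_apply g x) W"
    by blast
  have "c \<le> \<bar>blinfun_apply (h i) x\<bar>" for i
  proof (rule tendsto_lowerbound[OF tendsto_rabs[OF x] _ nb])
    show "eventually (\<lambda>k. c \<le> \<bar>blinfun_apply (h i) (s k)\<bar>) W"
      by (rule filter_leD[OF W(1) eventually_mono[OF eventually_gt_at_top[of i] upper]])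
  qed
  then have "c \<le> \<bar>blinfun_apply g x\<bar>"
    by (intro tendsto_lowerbound[OF tendsto_rabs[OF g] _ nb]) auto
  moreover have gs: "blinfun_apply g (s m) = 0" for m
    by (rule tendsto_unique[OF nb g[of "s m"]]) (rule tendsto_mono[OF W(1) lower])
  have "((\<lambda>m. 0) \<longlongrightarrow> blinfun_apply g x) W"
    using x[of g] unfolding gs .
  then have "blinfun_apply g x = 0" using nb by (simp add: tendsto_const_iff)
  ultimately show ?thesis by simp
qed

section \<open>Normalized weakly null filters\<close>
definition normalized_weakly_null :: "'a::real_normed_vector filter \<Rightarrow> bool" where
  "normalized_weakly_null F \<longleftrightarrow>
     (norm \<longlongrightarrow> 1) F \<and> (\<forall>f :: 'a \<Rightarrow>\<^sub>L real. (blinfun_apply f \<longlongrightarrow> 0) F)"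

lemma normalized_weakly_null_mono:
  "normalized_weakly_null G \<Longrightarrow> F \<le> G \<Longrightarrow> normalized_weakly_null F"
  by (auto simp: normalized_weakly_null_def intro: tendsto_mono)

lemma normalized_weakly_null_Sup:
  "(\<And>F. F \<in> \<F> \<Longrightarrow> normalized_weakly_null F) \<Longrightarrow> normalized_weakly_null (Sup \<F>)"
  by (auto simp: normalized_weakly_null_def tendsto_def eventually_Sup)

lemma normalized_weakly_null_norm:
  "normalized_weakly_null F \<Longrightarrow> (norm \<longlongrightarrow> 1) F"
  and normalized_weakly_null_apply:
  "normalized_weakly_null F \<Longrightarrow> (blinfun_apply (f :: _ \<Rightarrow>\<^sub>L real) \<longlongrightarrow> 0) F"
  by (auto simp: normalized_weakly_null_def)

text \<open>
  The common kernel of finitely many functionals has finite codimension.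
\<close>
lemma finite_span_mod_kernels:
  fixes B :: "('a::real_normed_vector \<Rightarrow>\<^sub>L real) set"
  assumes "finite B"
  shows "\<exists>C. finite C \<and> (\<forall>x. \<exists>c\<in>span C. \<forall>f\<in>B. blinfun_apply f (x - c) = 0)"
  using assms
proof (induction B rule: finite_induct)
  case empty
  show ?case by (intro exI[of _ "{}"]) auto
next
  case (insert f B)
  then obtain C where C: "finite C" "\<And>x. \<exists>c\<in>span C. \<forall>f\<in>B. blinfun_apply f (x - c) = 0" by blast
  show ?case
  proof (cases "\<exists>v. (\<forall>g\<in>B. blinfun_apply g v = 0) \<and> blinfun_apply f v \<noteq> 0")
    case False
    then show ?thesis using C by (metis insert_iff)
  next
    case True
    then obtain v where v: "\<And>g. g \<in> B \<Longrightarrow> blinfun_apply g v = 0" "blinfun_apply f v \<noteq> 0" by blast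
    have "\<exists>c\<in>span (insert v C). \<forall>g\<in>insert f B. blinfun_apply g (x - c) = 0" for x
    proof -
      obtain c where c: "c \<in> span C" "\<And>g. g \<in> B \<Longrightarrow> blinfun_apply g (x - c) = 0" using C(2) by blast
      define t where "t = blinfun_apply f (x - c) / blinfun_apply f v"
      have "c + t *\<^sub>R v \<in> span (insert v C)"
        using c(1) by (intro span_add span_scale) (auto intro: span_base span_mono[THEN subsetD, OF subset_insertI])
      moreover have "blinfun_apply g (x - (c + t *\<^sub>R v)) = 0" if "g \<in> insert f B" for g
        using that c(2)[of g] v
        by (auto simp: t_def blinfun.diff_right blinfun.add_right blinfun.scaleR_right)
      ultimately show ?thesis by blast
    qed
    then show ?thesis using C(1) by (intro exI[of _ "insert v C"]) auto
  qed
qed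

lemma ex_unit_vector_in_kernels:
  fixes B :: "('a::real_normed_vector \<Rightarrow>\<^sub>L real) set"
  assumes "infinite_dimensional TYPE('a)" "finite B"
  shows "\<exists>x. norm x = 1 \<and> (\<forall>f\<in>B. blinfun_apply f x = 0)"
proof -
  obtain C where C: "finite C" "\<And>x. \<exists>c\<in>span C. \<forall>f\<in>B. blinfun_apply f (x - c) = 0"
    using finite_span_mod_kernels[OF assms(2)] by blast
  obtain x where x: "x \<notin> span C" using assms(1) C(1) unfolding infinite_dimensional_def by blast
  obtain c where c: "c \<in> span C" "\<forall>f\<in>B. blinfun_apply f (x - c) = 0" using C(2) by blast
  have "x - c \<noteq> 0" using x c(1) by auto
  then show ?thesis using c(2)
    by (intro exI[of _ "(1 / norm (x - c)) *\<^sub>R (x - c)"]) (simp add: blinfun.scaleR_right)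
qed

lemma ex_normalized_weakly_null:
  assumes "infinite_dimensional TYPE('a::real_normed_vector)"
  shows "\<exists>F :: 'a filter. F \<noteq> bot \<and> normalized_weakly_null F"
proof (intro exI conjI)
  let ?K = "\<lambda>f :: 'a \<Rightarrow>\<^sub>L real. principal {x. norm x = 1 \<and> blinfun_apply f x = 0}"
  let ?F = "INF f. ?K f"
  show "?F \<noteq> bot"
  proof (rule INF_filter_not_bot)
    fix B :: "('a \<Rightarrow>\<^sub>L real) set" assume B: "finite B"
    obtain x where x: "norm x = 1" "\<forall>f\<in>B. blinfun_apply f x = 0"
      using ex_unit_vector_in_kernels[OF assms B] by blast
    have "principal {x} \<le> (INF f\<in>B. ?K f)" using x by (intro INF_greatest) auto
    then show "(INF f\<in>B. ?K f) \<noteq> bot" by (metis bot.extremum_uniqueI insert_not_empty principal_eq_bot_iff)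
  qed
  have ev: "eventually (\<lambda>x. norm x = 1 \<and> blinfun_apply f x = 0) ?F" for f :: "'a \<Rightarrow>\<^sub>L real"
    by (rule filter_leD[of _ "?K f"]) (auto intro: INF_lower simp: eventually_principal)
  show "normalized_weakly_null ?F"
    unfolding normalized_weakly_null_def
    by (auto intro!: tendsto_eventually eventually_mono[OF ev])
qed

section \<open>Antipodal sets from separated ultrafilters\<close>
lemma infinite_set_by_extension:
  assumes "Q {}" and ext: "\<And>F. finite F \<Longrightarrow> Q F \<Longrightarrow> \<exists>x. x \<notin> F \<and> Q (insert x F)"
  shows "\<exists>S. infinite S \<and> (\<forall>T. finite T \<longrightarrow> T \<subseteq> S \<longrightarrow> (\<exists>F. T \<subseteq> F \<and> Q F))"
proof -
  have "\<exists>f. \<forall>n::nat. (finite (f n) \<and> card (f n) = n \<and> Q (f n)) \<and> f n \<subseteq> f (Suc n)"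
  proof (rule dependent_nat_choice)
    show "\<exists>F. finite F \<and> card F = 0 \<and> Q F" using assms(1) by (intro exI[of _ "{}"]) auto
    fix F :: "'a set" and n assume F: "finite F \<and> card F = n \<and> Q F"
    then obtain x where "x \<notin> F" "Q (insert x F)" using ext by blast
    then show "\<exists>G. (finite G \<and> card G = Suc n \<and> Q G) \<and> F \<subseteq> G"
      using F by (intro exI[of _ "insert x F"]) auto
  qed
  then obtain f where "\<forall>n::nat. (finite (f n) \<and> card (f n) = n \<and> Q (f n)) \<and> f n \<subseteq> f (Suc n)" ..
  then have f: "finite (f n)" "card (f n) = n" "Q (f n)" "f n \<subseteq> f (Suc n)" for n
    by simp_all
  have mono: "f n \<subseteq> f m" if "n \<le> m" for n m using f(4) that by (rule lift_Suc_mono_le)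
  have "infinite (\<Union>n. f n)"
  proof
    assume "finite (\<Union>n. f n)"
    then have "card (f (Suc (card (\<Union>n. f n)))) \<le> card (\<Union>n. f n)" by (rule card_mono) auto
    then show False by (simp add: f(2))
  qed
  moreover
  have "\<exists>n. T \<subseteq> f n" if "finite T" "T \<subseteq> (\<Union>n. f n)" for T
    using that
  proof (induction T rule: finite_induct)
    case (insert x T)
    then obtain n m where "T \<subseteq> f n" "x \<in> f m" by auto
    then have "insert x T \<subseteq> f (max n m)" using mono[of n "max n m"] mono[of m "max n m"] by auto
    then show ?case ..
  qed simp
  then have "\<exists>F. T \<subseteq> F \<and> Q F" if "finite T" "T \<subseteq> (\<Union>n. f n)" for T
    using that f(3) by meson
  ultimately show ?thesis by (intro exI[of _ "\<Union>n. f n"]) simp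
qed

lemma eventually_abs_less:
  fixes g :: "'i \<Rightarrow> real"
  assumes "(g \<longlongrightarrow> l) F" "\<bar>l\<bar> < d" shows "eventually (\<lambda>i. \<bar>g i\<bar> < d) F"
  using order_tendstoD(2)[OF tendsto_rabs[OF assms(1)] assms(2)] .

lemma eventually_less_abs:
  fixes g :: "'i \<Rightarrow> real"
  assumes "(g \<longlongrightarrow> l) F" "d < \<bar>l\<bar>" shows "eventually (\<lambda>i. d < \<bar>g i\<bar>) F"
  using order_tendstoD(1)[OF tendsto_rabs[OF assms(1)] assms(2)] .

text \<open>
  The functional for the pair \<open>x, y\<close> is \<open>N (x - y)\<close>, where \<open>N\<close> chooses norming functionals. It must
  be small at the points selected before, between and after \<open>x\<close> and \<open>y\<close>. Points selected after
  both cause no difficulty as the ultrafilter is weakly null. For the others, let \<open>g x\<close> be the limit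
  of \<open>N (x - y)\<close> in \<open>y\<close> and \<open>f\<close> the limit of \<open>g x\<close> in \<open>x\<close>. If \<open>f\<close> is small at \<open>z\<close>, then so is \<open>g x\<close>
  for almost all later \<open>x\<close>; and if \<open>g x\<close> is small at \<open>z\<close>, then so is \<open>N (x - y)\<close> for almost all
  later \<open>y\<close>. Keeping these smallness conditions as part of the invariant \<open>Q\<close> means that every
  finite selection can be extended by almost every point.
\<close>
lemma separated_ultrafilter_selection:
  fixes U :: "'a::real_normed_vector filter"
  assumes U: "ultrafilter U" "normalized_weakly_null U"
    and pos: "0 < e" "0 < d" "1 < r"
    and sep: "eventually (\<lambda>x. eventually (\<lambda>y. 1 + e \<le> norm (x - y)) U) U"
  shows "\<exists>S. infinite S \<and> (\<forall>x\<in>S. norm x \<le> r) \<and>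
    (\<forall>x\<in>S. \<forall>y\<in>S. x \<noteq> y \<longrightarrow> (\<exists>f :: 'a \<Rightarrow>\<^sub>L real. norm f \<le> 1 \<and> 1 + e \<le> blinfun_apply f (x - y)
       \<and> (\<forall>z\<in>S. z \<noteq> x \<longrightarrow> z \<noteq> y \<longrightarrow> \<bar>blinfun_apply f z\<bar> < d)))"
proof -
  obtain N :: "'a \<Rightarrow> 'a \<Rightarrow>\<^sub>L real" where N: "\<And>v. norm (N v) \<le> 1"
    "\<And>v. blinfun_apply (N v) v = norm v" "\<And>v. N (- v) = - N v"
    using ex_odd_norming_map by metis
  have "\<forall>x. \<exists>h. norm h \<le> 1 \<and> (\<forall>z. ((\<lambda>y. blinfun_apply (N (x - y)) z) \<longlongrightarrow> blinfun_apply h z) U)"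
    by (intro allI ultrafilter_functional_limit[OF U(1)]) (rule N(1))
  from choice[OF this] obtain g where g: "\<And>x. norm (g x) \<le> 1"
    "\<And>x z. ((\<lambda>y. blinfun_apply (N (x - y)) z) \<longlongrightarrow> blinfun_apply (g x) z) U" by blast
  have "\<exists>f. norm f \<le> 1 \<and> (\<forall>z. ((\<lambda>x. blinfun_apply (g x) z) \<longlongrightarrow> blinfun_apply f z) U)"
    by (rule ultrafilter_functional_limit[OF U(1)]) (rule g(1))
  then obtain f where f: "\<And>z. ((\<lambda>x. blinfun_apply (g x) z) \<longlongrightarrow> blinfun_apply f z) U"
    by blast
  define Q where "Q F \<longleftrightarrow>
    (\<forall>x\<in>F. norm x \<le> r \<and> \<bar>blinfun_apply f x\<bar> < d \<and> eventually (\<lambda>y. 1 + e \<le> norm (x - y)) U) \<and>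
    (\<forall>x\<in>F. \<forall>y\<in>F. x \<noteq> y \<longrightarrow> 1 + e \<le> norm (x - y) \<and> \<bar>blinfun_apply (g x) y\<bar> < d) \<and>
    (\<forall>x\<in>F. \<forall>y\<in>F. \<forall>z\<in>F. x \<noteq> y \<longrightarrow> z \<noteq> x \<longrightarrow> z \<noteq> y \<longrightarrow> \<bar>blinfun_apply (N (x - y)) z\<bar> < d)" for F
  have null: "eventually (\<lambda>w. \<bar>blinfun_apply k w\<bar> < d) U" for k
    by (rule eventually_abs_less[OF normalized_weakly_null_apply[OF U(2)]]) (use pos in simp)
  \<comment> \<open>\<open>Q\<close> does not record the order of selection; as \<open>N\<close> is odd, the conditions on \<open>N (w - x)\<close> for a
    new point \<open>w\<close> follow from those on \<open>N (x - w)\<close>.\<close>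
  have ext: "\<exists>w. w \<notin> F \<and> Q (insert w F)" if F: "finite F" "Q F" for F
  proof -
    have Q1: "norm x \<le> r" "\<bar>blinfun_apply f x\<bar> < d" "eventually (\<lambda>y. 1 + e \<le> norm (x - y)) U"
      if "x \<in> F" for x using F(2) that by (simp_all add: Q_def)
    have Q2: "1 + e \<le> norm (x - y)" "\<bar>blinfun_apply (g x) y\<bar> < d" if "x \<in> F" "y \<in> F" "x \<noteq> y" for x y
      using F(2) that by (simp_all add: Q_def)
    have Q3: "\<bar>blinfun_apply (N (x - y)) z\<bar> < d"
      if "x \<in> F" "y \<in> F" "z \<in> F" "x \<noteq> y" "z \<noteq> x" "z \<noteq> y" for x y z
      using F(2) that by (simp add: Q_def)
    have "eventually (\<lambda>w. norm w < r) U"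
      using order_tendstoD(2)[OF normalized_weakly_null_norm[OF U(2)]] pos by simp
    moreover have "eventually (\<lambda>w. \<forall>x\<in>F. 1 + e \<le> norm (x - w)) U"
      using F(1) Q1(3) by (intro eventually_ball_finite) auto
    moreover have "eventually (\<lambda>w. \<forall>x\<in>F. \<bar>blinfun_apply (g x) w\<bar> < d) U"
      using F(1) null by (intro eventually_ball_finite) auto
    moreover have "eventually (\<lambda>w. \<forall>x\<in>F. \<bar>blinfun_apply (g w) x\<bar> < d) U"
      using F(1) Q1(2) by (intro eventually_ball_finite ballI eventually_abs_less[OF f]) auto
    moreover have "eventually (\<lambda>w. \<forall>x\<in>F. \<forall>y\<in>F. \<bar>blinfun_apply (N (x - y)) w\<bar> < d) U"
      using F(1) null by (intro eventually_ball_finite ballI) auto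
    moreover have "eventually (\<lambda>w. \<forall>x\<in>F. \<forall>z\<in>F - {x}. \<bar>blinfun_apply (N (x - w)) z\<bar> < d) U"
      using F(1) Q2(2) by (intro eventually_ball_finite ballI eventually_abs_less[OF g(2)]) auto
    ultimately have "eventually (\<lambda>w. w \<notin> F \<and> Q (insert w F)) U"
      using sep null[of f]
    proof eventually_elim
      case (elim w)
      have 1: "1 + e \<le> norm (x - w)" "1 + e \<le> norm (w - x)" if "x \<in> F" for x
        using elim(2) that by (auto simp: norm_minus_commute)
      have 2: "\<bar>blinfun_apply (N (w - x)) z\<bar> < d" "\<bar>blinfun_apply (N (x - w)) z\<bar> < d"
        if "x \<in> F" "z \<in> F" "z \<noteq> x" for x z
        using elim(6) that N(3)[of "x - w"] by (auto simp: blinfun.minus_left)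
      have "w \<notin> F" using 1(1)[of w] pos by auto
      moreover have "norm x \<le> r \<and> \<bar>blinfun_apply f x\<bar> < d \<and> eventually (\<lambda>y. 1 + e \<le> norm (x - y)) U"
        if "x \<in> insert w F" for x using that Q1 elim(1,7,8) by auto
      moreover have "1 + e \<le> norm (x - y) \<and> \<bar>blinfun_apply (g x) y\<bar> < d"
        if "x \<in> insert w F" "y \<in> insert w F" "x \<noteq> y" for x y
        using that Q2 1 elim(3,4) by auto
      moreover have "\<bar>blinfun_apply (N (x - y)) z\<bar> < d"
        if "x \<in> insert w F" "y \<in> insert w F" "z \<in> insert w F" "x \<noteq> y" "z \<noteq> x" "z \<noteq> y" for x y z
        using that Q3 2 elim(5) by auto
      ultimately show ?case unfolding Q_def by blast
    qed
    then show ?thesis using U(1) eventually_happens' unfolding ultrafilter_def by blast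
  qed
  have "Q {}" by (simp add: Q_def)
  have "\<exists>S. infinite S \<and> (\<forall>T. finite T \<longrightarrow> T \<subseteq> S \<longrightarrow> (\<exists>F. T \<subseteq> F \<and> Q F))"
    by (rule infinite_set_by_extension) fact+
  then obtain S where S: "infinite S" "\<And>T. finite T \<Longrightarrow> T \<subseteq> S \<Longrightarrow> \<exists>F. T \<subseteq> F \<and> Q F"
    by blast
  have "norm x \<le> r" if "x \<in> S" for x
    using S(2)[of "{x}"] that by (auto simp: Q_def)
  moreover have "\<exists>f :: 'a \<Rightarrow>\<^sub>L real. norm f \<le> 1 \<and> 1 + e \<le> blinfun_apply f (x - y)
       \<and> (\<forall>z\<in>S. z \<noteq> x \<longrightarrow> z \<noteq> y \<longrightarrow> \<bar>blinfun_apply f z\<bar> < d)"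
    if xy: "x \<in> S" "y \<in> S" "x \<noteq> y" for x y
  proof (intro exI[of _ "N (x - y)"] conjI ballI impI)
    show "1 + e \<le> blinfun_apply (N (x - y)) (x - y)"
      using S(2)[of "{x, y}"] xy by (auto simp: Q_def N(2))
    show "\<bar>blinfun_apply (N (x - y)) z\<bar> < d" if "z \<in> S" "z \<noteq> x" "z \<noteq> y" for z
      using S(2)[of "{x, y, z}"] xy that by (auto simp: Q_def)
  qed (rule N(1))
  ultimately show ?thesis using S(1) by blast
qed

text \<open>
  The selected points have norm at most \<open>r = 1 + e / 4\<close>, so a functional of norm \<open>1\<close> with
  increment \<open>1 + e\<close> from \<open>y\<close> to \<open>x\<close> is at least \<open>3 * e / 4\<close> at \<open>x\<close> and at most \<open>- 3 * e / 4\<close> at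
  \<open>y\<close>. Values below \<open>e / 2\<close> in modulus lie in between, and division by \<open>r\<close> moves the points into the
  unit ball while keeping the increment above \<open>1\<close>.
\<close>
lemma separated_ultrafilter_K_a:
  fixes U :: "'a::real_normed_vector filter"
  assumes U: "ultrafilter U" "normalized_weakly_null U" and e: "0 < e"
    and sep: "eventually (\<lambda>x. eventually (\<lambda>y. 1 + e \<le> norm (x - y)) U) U"
  shows "\<exists>d>1. d \<in> K_a_set TYPE('a)"
proof -
  define r where "r = 1 + e / 4"
  have r: "1 < r" "0 < r" "0 < e / 2" using e by (auto simp: r_def)
  from separated_ultrafilter_selection[OF U e r(3,1) sep]
  obtain S where S: "infinite S" "\<And>x. x \<in> S \<Longrightarrow> norm x \<le> r"
    and func: "\<And>x y. x \<in> S \<Longrightarrow> y \<in> S \<Longrightarrow> x \<noteq> y \<Longrightarrow>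
       \<exists>f :: 'a \<Rightarrow>\<^sub>L real. norm f \<le> 1 \<and> 1 + e \<le> blinfun_apply f (x - y)
       \<and> (\<forall>z\<in>S. z \<noteq> x \<longrightarrow> z \<noteq> y \<longrightarrow> \<bar>blinfun_apply f z\<bar> < e / 2)"
    by auto
  let ?c = "\<lambda>x :: 'a. (1 / r) *\<^sub>R x"
  have "inj_on ?c S" using r by (auto simp: inj_on_def)
  then have "infinite (?c ` S)" using S(1) finite_imageD by blast
  moreover have ball: "?c ` S \<subseteq> cball 0 1" using S(2) r by auto
  moreover have "bsa 1 1 ((1 + e) / r) (?c ` S)"
    unfolding bsa_def
  proof (intro conjI ballI impI)
    fix u assume "u \<in> ?c ` S" then show "norm u \<le> 1" using ball by auto
  next
    fix v u assume "v \<in> ?c ` S" "u \<in> ?c ` S" "v \<noteq> u"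
    then obtain x y where xy: "x \<in> S" "y \<in> S" "x \<noteq> y" "u = ?c x" "v = ?c y" by auto
    then obtain f :: "'a \<Rightarrow>\<^sub>L real" where f: "norm f \<le> 1" "1 + e \<le> blinfun_apply f x - blinfun_apply f y"
      "\<And>z. z \<in> S \<Longrightarrow> z \<noteq> x \<Longrightarrow> z \<noteq> y \<Longrightarrow> \<bar>blinfun_apply f z\<bar> < e / 2"
      using func[of x y] by (auto simp: blinfun.diff_right)
    have b: "\<bar>blinfun_apply f z\<bar> \<le> r" if "z \<in> S" for z
      using norm_blinfun[of f z] mult_mono[OF f(1) S(2)[OF that]] by simp
    have fx: "e / 2 \<le> blinfun_apply f x" "blinfun_apply f y \<le> - (e / 2)"
      using b[OF xy(1)] b[OF xy(2)] f(2) e by (auto simp: r_def)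
    have mid: "blinfun_apply f y \<le> blinfun_apply f z" "blinfun_apply f z \<le> blinfun_apply f x" if "z \<in> S" for z
      using f(3)[OF that] fx e by (cases "z = x"; cases "z = y"; force)+
    show "\<exists>f :: 'a \<Rightarrow>\<^sub>L real. norm f \<le> 1 \<and> (1 + e) / r \<le> blinfun_apply f u - blinfun_apply f v \<and>
       (\<forall>z\<in>?c ` S. blinfun_apply f v \<le> blinfun_apply f z \<and> blinfun_apply f z \<le> blinfun_apply f u)"
      using f(1,2) mid r xy(4,5)
      by (intro exI[of _ f]) (auto simp: blinfun.scaleR_right divide_right_mono simp flip: diff_divide_distrib)
  qed
  moreover have "1 < (1 + e) / r" using e r by (simp add: r_def)
  ultimately show ?thesis unfolding K_a_set_def
    by (intro exI[of _ "(1 + e) / r"]) auto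
qed

section \<open>Filters invariant under differences\<close>

text \<open>
  A filter \<open>F\<close> stands for the closed set of ultrafilters below it. For an ultrafilter \<open>U\<close>, the sets
  \<open>E\<close> with \<open>x - y \<in> E\<close> for \<open>U\<close>-almost all \<open>x\<close> and then \<open>U\<close>-almost all \<open>y\<close> form an ultrafilter
  \<open>\<Delta> U\<close>; the filter defined here stands for the closure of the set of all \<open>\<Delta> U\<close> with \<open>U \<le> F\<close>.
\<close>
definition difference_filter :: "'a::real_normed_vector filter \<Rightarrow> 'a filter" where
  "difference_filter F = Abs_filter (\<lambda>E. \<forall>U\<le>F. ultrafilter U \<longrightarrow>
     eventually (\<lambda>x. eventually (\<lambda>y. E (x - y)) U) U)"

lemma eventually_difference_filter:
  "eventually E (difference_filter F) \<longleftrightarrow> (\<forall>U\<le>F. ultrafilter U \<longrightarrow>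
     eventually (\<lambda>x. eventually (\<lambda>y. E (x - y)) U) U)"
  unfolding difference_filter_def
proof (rule eventually_Abs_filter, rule is_filter.intro)
  fix P Q :: "'a \<Rightarrow> bool"
  assume "\<forall>U\<le>F. ultrafilter U \<longrightarrow> eventually (\<lambda>x. eventually (\<lambda>y. P (x - y)) U) U"
    "\<forall>U\<le>F. ultrafilter U \<longrightarrow> eventually (\<lambda>x. eventually (\<lambda>y. Q (x - y)) U) U"
  then show "\<forall>U\<le>F. ultrafilter U \<longrightarrow> eventually (\<lambda>x. eventually (\<lambda>y. P (x - y) \<and> Q (x - y)) U) U"
    by (simp add: eventually_conj_iff)
next
  fix P Q :: "'a \<Rightarrow> bool"
  assume "\<forall>x. P x \<longrightarrow> Q x" "\<forall>U\<le>F. ultrafilter U \<longrightarrow> eventually (\<lambda>x. eventually (\<lambda>y. P (x - y)) U) U"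
  then show "\<forall>U\<le>F. ultrafilter U \<longrightarrow> eventually (\<lambda>x. eventually (\<lambda>y. Q (x - y)) U) U"
    by (blast intro: eventually_mono)
qed auto

lemma difference_filter_mono: "F \<le> G \<Longrightarrow> difference_filter F \<le> difference_filter G"
  by (auto simp: le_filter_def[of "difference_filter F"] eventually_difference_filter intro: order_trans)

lemma difference_filter_not_bot:
  assumes "F \<noteq> bot" shows "difference_filter F \<noteq> bot"
proof -
  obtain U where U: "U \<le> F" "ultrafilter U" using ex_ultrafilter_le[OF assms] by blast
  then have "\<not> eventually (\<lambda>x. eventually (\<lambda>y. False) U) U" by (simp add: ultrafilter_def trivial_limit_def)
  then have "\<not> eventually (\<lambda>_. False) (difference_filter F)"
    using U unfolding eventually_difference_filter by blast
  then show ?thesis by (simp add: trivial_limit_def)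
qed

text \<open>
  An open set that meets the closure of the set of all \<open>\<Delta> U\<close> contains some \<open>\<Delta> U\<close>.
\<close>
lemma frequently_difference_filter:
  assumes "frequently E (difference_filter F)"
  shows "\<exists>U\<le>F. ultrafilter U \<and> eventually (\<lambda>x. eventually (\<lambda>y. E (x - y)) U) U"
proof -
  obtain U where U: "U \<le> F" "ultrafilter U"
    "\<not> eventually (\<lambda>x. eventually (\<lambda>y. \<not> E (x - y)) U) U"
    using assms unfolding frequently_def eventually_difference_filter by blast
  have "eventually (\<lambda>x. eventually (\<lambda>y. E (x - y)) U) U"
    using U(3) by (simp add: ultrafilter_not_eventually[OF U(2)])
  then show ?thesis using U by blast
qed

text \<open>
  For the upper bound on the norm, an ultrafilter whose differences have norm at least \<open>a > 1\<close>
  would be separated. For the lower bound, a functional that norms \<open>x\<close> is almost \<open>0\<close> at almost all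
  \<open>y\<close>, so \<open>\<parallel>x - y\<parallel>\<close> is asymptotically at least \<open>\<parallel>x\<parallel>\<close>.
\<close>
lemma normalized_weakly_null_difference_filter:
  fixes F :: "'a::real_normed_vector filter"
  assumes none: "\<not> (\<exists>d>1. d \<in> K_a_set TYPE('a))" and F: "normalized_weakly_null F"
  shows "normalized_weakly_null (difference_filter F)"
  unfolding normalized_weakly_null_def
proof (intro conjI allI)
  have U_null: "normalized_weakly_null U" if "U \<le> F" for U
    using normalized_weakly_null_mono[OF F that] .
  show "(norm \<longlongrightarrow> 1) (difference_filter F)"
  proof (rule order_tendstoI)
    fix a :: real assume a: "a < 1"
    show "eventually (\<lambda>x. a < norm x) (difference_filter F)"
      unfolding eventually_difference_filter
    proof (intro allI impI)
      fix U assume U: "U \<le> F" "ultrafilter U"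
      have "eventually (\<lambda>x. (a + 1) / 2 < norm x) U"
        by (rule order_tendstoD(1)[OF normalized_weakly_null_norm[OF U_null[OF U(1)]]]) (use a in simp)
      then show "eventually (\<lambda>x. eventually (\<lambda>y. a < norm (x - y)) U) U"
      proof eventually_elim
        case (elim x)
        obtain f :: "'a \<Rightarrow>\<^sub>L real" where f: "norm f \<le> 1" "blinfun_apply f x = norm x"
          using ex_norming_functional by blast
        have "eventually (\<lambda>y. \<bar>blinfun_apply f y\<bar> < (1 - a) / 2) U"
          by (rule eventually_abs_less[OF normalized_weakly_null_apply[OF U_null[OF U(1)]]]) (use a in simp)
        then show ?case
        proof eventually_elim
          case (elim y)
          have "blinfun_apply f (x - y) \<le> norm (x - y)"
            using norm_blinfun[of f "x - y"] mult_right_mono[OF f(1) norm_ge_zero[of "x - y"]] by simp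
          then show ?case using elim f(2) \<open>(a + 1) / 2 < norm x\<close>
            by (simp add: blinfun.diff_right abs_less_iff field_simps)
        qed
      qed
    qed
  next
    fix a :: real assume a: "1 < a"
    show "eventually (\<lambda>x. norm x < a) (difference_filter F)"
      unfolding eventually_difference_filter
    proof (intro allI impI, rule ccontr)
      fix U assume U: "U \<le> F" "ultrafilter U"
        and "\<not> eventually (\<lambda>x. eventually (\<lambda>y. norm (x - y) < a) U) U"
      then have "eventually (\<lambda>x. eventually (\<lambda>y. 1 + (a - 1) \<le> norm (x - y)) U) U"
        by (simp add: ultrafilter_not_eventually not_less)
      then show False
        using separated_ultrafilter_K_a[OF U(2) U_null[OF U(1)], of "a - 1"] a none by simp
    qed
  qed
  fix f :: "'a \<Rightarrow>\<^sub>L real"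
  show "(blinfun_apply f \<longlongrightarrow> 0) (difference_filter F)"
    unfolding tendsto_iff eventually_difference_filter
  proof (intro allI impI)
    fix c :: real and U assume c: "0 < c" and U: "U \<le> F" "ultrafilter U"
    have ev: "eventually (\<lambda>x. \<bar>blinfun_apply f x\<bar> < c / 2) U"
      by (rule eventually_abs_less[OF normalized_weakly_null_apply[OF U_null[OF U(1)]]]) (use c in simp)
    then show "eventually (\<lambda>x. eventually (\<lambda>y. dist (blinfun_apply f (x - y)) 0 < c) U) U"
    proof eventually_elim
      case (elim x)
      from ev show ?case by eventually_elim (use elim in \<open>simp add: blinfun.diff_right\<close>)
    qed
  qed
qed

text \<open>
  The largest normalized weakly null filter contains its differences. Among the proper filters
  with this property a minimal one is equal to its difference filter, because the
  difference filter has the property as well.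
\<close>
lemma ex_difference_invariant_filter:
  assumes "infinite_dimensional TYPE('a::real_normed_vector)"
    and none: "\<not> (\<exists>d>1. d \<in> K_a_set TYPE('a))"
  shows "\<exists>F :: 'a filter. F \<noteq> bot \<and> normalized_weakly_null F \<and> difference_filter F = F"
proof -
  define Q :: "'a filter \<Rightarrow> bool" where "Q F \<longleftrightarrow> normalized_weakly_null F \<and> difference_filter F \<le> F" for F
  define F0 :: "'a filter" where "F0 = Sup {F. normalized_weakly_null F}"
  have F0: "normalized_weakly_null F0" unfolding F0_def by (rule normalized_weakly_null_Sup) simp
  have "difference_filter F0 \<le> F0"
    using normalized_weakly_null_difference_filter[OF none F0]
    by (subst (2) F0_def) (simp add: Sup_upper)
  then have "Q F0" using F0 by (simp add: Q_def)
  moreover obtain G :: "'a filter" where "G \<noteq> bot" "normalized_weakly_null G"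
    using ex_normalized_weakly_null[OF assms(1)] by blast
  then have "G \<noteq> bot" "G \<le> F0" by (simp_all add: F0_def Sup_upper)
  then have "F0 \<noteq> bot" using bot.extremum_uniqueI by blast
  moreover have "Q (Inf C)" if C: "C \<noteq> {}" "\<And>F. F \<in> C \<Longrightarrow> Q F" for C
  proof -
    have "difference_filter (Inf C) \<le> F" if "F \<in> C" for F
      by (rule order_trans[OF difference_filter_mono[OF Inf_lower[OF that]]])
        (use C(2)[OF that] in \<open>simp add: Q_def\<close>)
    moreover have "normalized_weakly_null (Inf C)"
    proof -
      obtain F where "F \<in> C" using C(1) by blast
      then show ?thesis
        using C(2) normalized_weakly_null_mono[of F "Inf C"] by (simp add: Q_def Inf_lower)
    qed
    ultimately show ?thesis by (auto simp: Q_def intro: Inf_greatest)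
  qed
  ultimately have "\<exists>F\<le>F0. F \<noteq> bot \<and> Q F \<and> (\<forall>G\<le>F. G \<noteq> bot \<longrightarrow> Q G \<longrightarrow> G = F)"
    by (intro ex_minimal_filter) blast+
  then obtain F where F: "F \<noteq> bot" "normalized_weakly_null F" "difference_filter F \<le> F"
    and min: "\<forall>G\<le>F. G \<noteq> bot \<longrightarrow> Q G \<longrightarrow> G = F" by (auto simp: Q_def)
  have "Q (difference_filter F)"
    unfolding Q_def using normalized_weakly_null_mono[OF F(2,3)] difference_filter_mono[OF F(3)] ..
  then have "difference_filter F = F"
    using min F(3) difference_filter_not_bot[OF F(1)] by blast
  then show ?thesis using F(1,2) by blast
qed

section \<open>Bounded alternating sums\<close>

text \<open>Weak lower semicontinuity of the norm.\<close>
lemma norm_le_of_frequently_translate: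
  assumes F: "normalized_weakly_null F" and fr: "frequently (\<lambda>y. norm (x + c *\<^sub>R y) \<le> B) F"
  shows "norm x \<le> B"
proof (rule field_le_epsilon)
  fix e :: real assume e: "0 < e"
  obtain f where f: "norm f \<le> 1" "blinfun_apply f x = norm x"
    using ex_norming_functional by blast
  have "((\<lambda>y. c * blinfun_apply f y) \<longlongrightarrow> c * 0) F"
    by (intro tendsto_mult_left normalized_weakly_null_apply F)
  then have "eventually (\<lambda>y. \<bar>c * blinfun_apply f y\<bar> < e) F" using e by (intro eventually_abs_less) auto
  then obtain y where y: "norm (x + c *\<^sub>R y) \<le> B" "\<bar>c * blinfun_apply f y\<bar> < e"
    using frequently_ex[OF frequently_eventually_frequently[OF fr]] by blast
  have "blinfun_apply f (x + c *\<^sub>R y) \<le> norm (x + c *\<^sub>R y)"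
    using norm_blinfun[of f "x + c *\<^sub>R y"] mult_right_mono[OF f(1) norm_ge_zero[of "x + c *\<^sub>R y"]] by simp
  then show "norm x \<le> B + e"
    using y f(2) by (simp add: blinfun.add_right blinfun.scaleR_right)
qed

text \<open>
  One step of the construction: \<open>x\<close> is the current partial sum, \<open>c\<close> the sign of the next
  summand, \<open>S\<close> the set of partial sums and \<open>H\<close> the set of functionals constructed so far. The
  invariant is that \<open>x + c *\<^sub>R y\<close> has norm at most \<open>2\<close> for frequently many \<open>y\<close>. As \<open>F\<close> is its own
  difference filter, \<open>y\<close> can be replaced by \<open>y - y'\<close> with \<open>y\<close> and \<open>y'\<close> following some ultrafilter
  \<open>U \<le> F\<close>. Fixing a generic \<open>y\<close> gives the next partial sum \<open>x + c *\<^sub>R y\<close>, and \<open>y'\<close> takes over the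
  former role of \<open>y\<close> with the opposite sign.
\<close>
lemma difference_invariant_step:
  fixes F :: "'a::real_normed_vector filter" and H :: "('a \<Rightarrow>\<^sub>L real) set"
  assumes F: "normalized_weakly_null F" "difference_filter F = F"
    and fin: "finite S" "finite H" and x: "x \<in> S" and c: "\<bar>c\<bar> = 1" and e: "0 < e"
    and fr: "frequently (\<lambda>y. norm (x + c *\<^sub>R y) \<le> 2) F"
    and H: "\<And>h. h \<in> H \<Longrightarrow> 1/2 < \<bar>blinfun_apply h x\<bar>"
  shows "\<exists>x' (h :: 'a \<Rightarrow>\<^sub>L real). frequently (\<lambda>y. norm (x' + (- c) *\<^sub>R y) \<le> 2) F \<and> norm h \<le> 2 \<and>
    (\<forall>k\<in>insert h H. 1/2 < \<bar>blinfun_apply k x'\<bar>) \<and> (\<forall>s\<in>S. \<bar>blinfun_apply h s\<bar> < e)"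
proof -
  obtain U where U: "U \<le> F" "ultrafilter U"
    and ev: "eventually (\<lambda>y. eventually (\<lambda>y'. norm (x + c *\<^sub>R (y - y')) \<le> 2) U) U"
    using frequently_difference_filter[of "\<lambda>y. norm (x + c *\<^sub>R y) \<le> 2" F] fr F(2) by auto
  have nb: "U \<noteq> bot" using U(2) by (simp add: ultrafilter_def)
  have null: "normalized_weakly_null U" using normalized_weakly_null_mono[OF F(1) U(1)] .
  obtain N :: "'a \<Rightarrow> 'a \<Rightarrow>\<^sub>L real" where N: "\<And>v. norm (N v) \<le> 1" "\<And>v. blinfun_apply (N v) v = norm v"
    using ex_norming_functional by metis
  have "\<exists>g. norm g \<le> 1 \<and> (\<forall>z. ((\<lambda>y. blinfun_apply (N y) z) \<longlongrightarrow> blinfun_apply g z) U)"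
    by (rule ultrafilter_functional_limit[OF U(2)]) (rule N(1))
  then obtain g where g: "norm g \<le> 1" "\<And>z. ((\<lambda>y. blinfun_apply (N y) z) \<longlongrightarrow> blinfun_apply g z) U"
    by blast
  \<comment> \<open>Subtracting the limit \<open>g\<close> makes the functional small at all earlier partial sums. Its value at
    \<open>y\<close> is still almost \<open>1\<close>, since \<open>g y\<close> tends to \<open>0\<close>.\<close>
  define h where "h y = N y - g" for y
  have h_norm: "norm (h y) \<le> 2" for y
    using norm_triangle_ineq4[of "N y" g] N(1)[of y] g(1) by (simp add: h_def)
  have h0: "((\<lambda>y. blinfun_apply (h y) z) \<longlongrightarrow> 0) U" for z
    using tendsto_diff[OF g(2)[of z] tendsto_const[of "blinfun_apply g z"]] by (simp add: h_def blinfun.diff_left)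
  have h1: "((\<lambda>y. blinfun_apply (h y) y) \<longlongrightarrow> 1) U"
    using tendsto_diff[OF normalized_weakly_null_norm[OF null] normalized_weakly_null_apply[OF null, of g]]
    by (simp add: h_def blinfun.diff_left N(2))
  have "((\<lambda>y. blinfun_apply (h y) (x + c *\<^sub>R y)) \<longlongrightarrow> c) U"
    using tendsto_add[OF h0[of x] tendsto_mult_left[OF h1, of c]]
    by (simp add: blinfun.add_right blinfun.scaleR_right)
  then have e1: "eventually (\<lambda>y. 1/2 < \<bar>blinfun_apply (h y) (x + c *\<^sub>R y)\<bar>) U"
    using c by (intro eventually_less_abs) auto
  have "((\<lambda>y. blinfun_apply k (x + c *\<^sub>R y)) \<longlongrightarrow> blinfun_apply k x) U" for k :: "'a \<Rightarrow>\<^sub>L real"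
    using tendsto_add[OF tendsto_const[of "blinfun_apply k x"] tendsto_mult_left[OF normalized_weakly_null_apply[OF null, of k], of c]]
    by (simp add: blinfun.add_right blinfun.scaleR_right)
  then have e2: "eventually (\<lambda>y. \<forall>k\<in>H. 1/2 < \<bar>blinfun_apply k (x + c *\<^sub>R y)\<bar>) U"
    using fin(2) H by (intro eventually_ball_finite ballI eventually_less_abs) auto
  have e3: "eventually (\<lambda>y. \<forall>s\<in>S. \<bar>blinfun_apply (h y) s\<bar> < e) U"
    using fin(1) e by (intro eventually_ball_finite ballI eventually_abs_less[OF h0]) auto
  obtain y where y: "eventually (\<lambda>y'. norm (x + c *\<^sub>R (y - y')) \<le> 2) U"
    "1/2 < \<bar>blinfun_apply (h y) (x + c *\<^sub>R y)\<bar>" "\<forall>k\<in>H. 1/2 < \<bar>blinfun_apply k (x + c *\<^sub>R y)\<bar>"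
    "\<forall>s\<in>S. \<bar>blinfun_apply (h y) s\<bar> < e"
    using eventually_happens'[OF nb eventually_conj[OF ev eventually_conj[OF e1 eventually_conj[OF e2 e3]]]] by auto
  have "eventually (\<lambda>y'. norm ((x + c *\<^sub>R y) + (- c) *\<^sub>R y') \<le> 2) U"
    using y(1) by (simp add: algebra_simps)
  then have "frequently (\<lambda>y'. norm ((x + c *\<^sub>R y) + (- c) *\<^sub>R y') \<le> 2) F"
    using nb U(1) by (meson eventually_frequently frequently_def filter_leD)
  then show ?thesis using y(2-4) h_norm by blast
qed

text \<open>
  The steps yield bounded partial sums \<open>s n\<close> and functionals, where a functional is small at the
  partial sums before it and stays above \<open>1/2\<close> in modulus at all later ones. In a
  reflexive space the iterated limits rule this out.
\<close>
lemma no_difference_invariant_filter: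
  fixes F :: "'a::real_normed_vector filter"
  assumes refl: "reflexive_space TYPE('a)"
    and F: "F \<noteq> bot" "normalized_weakly_null F" "difference_filter F = F"
  shows False
proof -
  \<comment> \<open>A state consists of the partial sums and functionals so far, the next sign, the current partial
    sum and the most recent functional.\<close>
  define P :: "nat \<Rightarrow> 'a set \<times> ('a \<Rightarrow>\<^sub>L real) set \<times> real \<times> 'a \<times> ('a \<Rightarrow>\<^sub>L real) \<Rightarrow> bool" where
    "P n = (\<lambda>(S, H, c, x, h). finite S \<and> finite H \<and> \<bar>c\<bar> = 1 \<and> x \<in> S \<and> norm h \<le> 2 \<and>
      frequently (\<lambda>y. norm (x + c *\<^sub>R y) \<le> 2) F \<and> (\<forall>k\<in>H. 1/2 < \<bar>blinfun_apply k x\<bar>))" for n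
  define R :: "nat \<Rightarrow> 'a set \<times> ('a \<Rightarrow>\<^sub>L real) set \<times> real \<times> 'a \<times> ('a \<Rightarrow>\<^sub>L real) \<Rightarrow>
      'a set \<times> ('a \<Rightarrow>\<^sub>L real) set \<times> real \<times> 'a \<times> ('a \<Rightarrow>\<^sub>L real) \<Rightarrow> bool" where
    "R n = (\<lambda>(S, H, c, x, h) (S', H', c', x', h'). S' = insert x' S \<and> H' = insert h' H \<and>
      (\<forall>s\<in>S. \<bar>blinfun_apply h' s\<bar> < 1 / real (Suc n)))" for n
  have "\<exists>st. \<forall>n. P n (st n) \<and> R n (st n) (st (Suc n))"
  proof (rule dependent_nat_choice)
    have "eventually (\<lambda>y :: 'a. norm y < 2) F"
      using order_tendstoD(2)[OF normalized_weakly_null_norm[OF F(2)], of 2] by simp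
    then have "frequently (\<lambda>y :: 'a. norm y \<le> 2) F"
      using F(1) by (intro eventually_frequently) (auto elim: eventually_mono)
    then show "\<exists>st. P 0 st"
      by (intro exI[of _ "({0}, {}, 1, 0, 0)"]) (simp add: P_def)
  next
    fix st n assume st: "P n st"
    obtain S H c x h where [simp]: "st = (S, H, c, x, h)" by (cases st) auto
    have S: "finite S" "finite H" "x \<in> S" "\<bar>c\<bar> = 1" "0 < 1 / real (Suc n)" 
      "frequently (\<lambda>y. norm (x + c *\<^sub>R y) \<le> 2) F" "\<And>k. k \<in> H \<Longrightarrow> 1/2 < \<bar>blinfun_apply k x\<bar>"
      using st by (auto simp: P_def)
    from difference_invariant_step[OF F(2,3) S] obtain x' h' where
      "frequently (\<lambda>y. norm (x' + (- c) *\<^sub>R y) \<le> 2) F" "norm h' \<le> 2"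
      "\<forall>k\<in>insert h' H. 1/2 < \<bar>blinfun_apply k x'\<bar>" "\<forall>s\<in>S. \<bar>blinfun_apply h' s\<bar> < 1 / real (Suc n)"
      by blast
    then show "\<exists>st'. P (Suc n) st' \<and> R n st st'"
      using S by (intro exI[of _ "(insert x' S, insert h' H, - c, x', h')"]) (simp add: P_def R_def)
  qed
  then obtain st where st: "\<And>n. P n (st n)" "\<And>n. R n (st n) (st (Suc n))" by blast
  define S H c s h where defs: "S = fst \<circ> st" "H = fst \<circ> snd \<circ> st" "c = fst \<circ> snd \<circ> snd \<circ> st"
    "s = fst \<circ> snd \<circ> snd \<circ> snd \<circ> st" "h = snd \<circ> snd \<circ> snd \<circ> snd \<circ> st"
  have st_eq: "st n = (S n, H n, c n, s n, h n)" for n by (simp add: defs)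
  have P: "s n \<in> S n" "norm (h n) \<le> 2" "frequently (\<lambda>y. norm (s n + c n *\<^sub>R y) \<le> 2) F"
    "\<And>k. k \<in> H n \<Longrightarrow> 1/2 < \<bar>blinfun_apply k (s n)\<bar>" for n
    using st(1)[of n] by (auto simp: P_def st_eq)
  have R: "S (Suc n) = insert (s (Suc n)) (S n)" "H (Suc n) = insert (h (Suc n)) (H n)"
    "\<And>z. z \<in> S n \<Longrightarrow> \<bar>blinfun_apply (h (Suc n)) z\<bar> < 1 / real (Suc n)" for n
    using st(2)[of n] by (auto simp: R_def st_eq)
  have S_mono: "S m \<subseteq> S n" if "m \<le> n" for m n using that by (rule lift_Suc_mono_le[rotated]) (auto simp: R)
  have H_mono: "H m \<subseteq> H n" if "m \<le> n" for m n using that by (rule lift_Suc_mono_le[rotated]) (auto simp: R)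
  \<comment> \<open>The functional of the initial state is a dummy, hence the shift to \<open>h (Suc i)\<close>; it belongs to
    the step from \<open>s i\<close> to \<open>s (Suc i)\<close>.\<close>
  have "(1/2 :: real) \<le> 0"
  proof (rule reflexive_iterated_limits[OF refl])
    show "norm (s k) \<le> 2" for k using norm_le_of_frequently_translate[OF F(2) P(3)] .
    show "norm (h (Suc i)) \<le> 2" for i by (rule P)
    show "1/2 \<le> \<bar>blinfun_apply (h (Suc i)) (s k)\<bar>" if "i < k" for i k
      using P(4)[of "h (Suc i)" k] H_mono[of "Suc i" k] R(2)[of i] that by fastforce
    show "(\<lambda>i. blinfun_apply (h (Suc i)) (s m)) \<longlonglongrightarrow> 0" for m
    proof (rule Lim_null_comparison)
      show "eventually (\<lambda>i. norm (blinfun_apply (h (Suc i)) (s m)) \<le> 1 / real (Suc i)) sequentially"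
        using eventually_ge_at_top[of m]
      proof eventually_elim
        case (elim i)
        then have "s m \<in> S i" using P(1)[of m] S_mono by blast
        then show ?case using R(3)[of "s m" i] by simp
      qed
      show "(\<lambda>i. 1 / real (Suc i)) \<longlonglongrightarrow> 0" using LIMSEQ_inverse_real_of_nat by (simp add: inverse_eq_divide)
    qed
  qed
  then show False by simp
qed

section \<open>The antipodal Kottman constant of a reflexive space\<close>
theorem corollary1p8:
  assumes "infinite_dimensional TYPE('a::banach)"
    and "reflexive_space TYPE('a)"
  shows "K_a TYPE('a) > 1"
proof -
  obtain d where "1 < d" "d \<in> K_a_set TYPE('a)"
    using ex_difference_invariant_filter[OF assms(1)] no_difference_invariant_filter[OF assms(2)] by blast
  then show ?thesis
    unfolding K_a_def using cSup_upper[OF _ bdd_above_K_a_set] by fastforce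
qed

end
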